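(* Let $X$ be a real Banach space which is not isomorphic to a Hilbert space, and let $q:X\to\mathbb{R}$ be a continuous quadratic form. Then for any $\varepsilon>0$ there exists $x\in X$ such that $$q(x)<\varepsilon\,\|q'(x)\|\,\|x\|.$$
   Context: "Isomorphic" means linearly homeomorphic. A continuous quadratic form on a real normed space $X$ is a function $q:X\to\mathbb{R}$ for which there exists a bounded bilinear form $a:X\times X\to\mathbb{R}$ such that $q(x)=\frac12 a(x,x)$ for all $x\in X$. Such a $q$ is everywhere Fréchet differentiable; $q'(x)\in X^\ast$ denotes its Fréchet derivative at $x$, and $\|q'(x)\|$ is its norm in the dual space $X^\ast$.
   Formalization: The quadratic form q is assumed not identically zero; for q = 0 the strict inequality reads 0 < 0 at every x, so the claim as printed fails for that one form. *)

theory Defs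
  imports "HOL-Analysis.Analysis"
begin

definition continuous_quadratic_form :: "('a::real_normed_vector \<Rightarrow> real) \<Rightarrow> bool" where
  "continuous_quadratic_form q \<longleftrightarrow>
     (\<exists>a :: 'a \<Rightarrow> 'a \<Rightarrow> real. bounded_bilinear a \<and> (\<forall>x. q x = 1/2 * a x x))"

text \<open>
  \<open>isomorphic_to_Hilbert_space TYPE('a)\<close>: there are a Hilbert space \<open>H\<close> and a linear homeomorphism
  \<open>T\<close> from \<open>'a\<close> onto \<open>H\<close>. HOL cannot quantify over the type underlying \<open>H\<close>, so \<open>H\<close> is given by
  arbitrary operations on \<open>'a\<close> that satisfy the axioms of the type classes \<open>real_inner\<close> and
  \<open>complete_space\<close>; these operations need not be related to the given ones on \<open>'a\<close>. As \<open>T\<close> is a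
  bijection, every Hilbert space isomorphic to \<open>'a\<close> has a copy with underlying set \<open>'a\<close>, so the
  choice of the underlying set is no restriction; see \<open>isomorphic_to_Hilbert_spaceI\<close> below.
\<close>

definition isomorphic_to_Hilbert_space :: "'a::real_normed_vector itself \<Rightarrow> bool" where
  "isomorphic_to_Hilbert_space (_ :: 'a itself) \<longleftrightarrow>
     (\<exists>(minusH :: 'a \<Rightarrow> 'a \<Rightarrow> 'a) (distH :: 'a \<Rightarrow> 'a \<Rightarrow> real) (normH :: 'a \<Rightarrow> real)
        (plusH :: 'a \<Rightarrow> 'a \<Rightarrow> 'a) (zeroH :: 'a) (uminusH :: 'a \<Rightarrow> 'a)
        (scaleH :: real \<Rightarrow> 'a \<Rightarrow> 'a) (sgnH :: 'a \<Rightarrow> 'a) (uniformityH :: ('a \<times> 'a) filter)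
        (openH :: 'a set \<Rightarrow> bool) (innerH :: 'a \<Rightarrow> 'a \<Rightarrow> real) (T :: 'a \<Rightarrow> 'a).
        class.real_inner minusH distH normH plusH zeroH uminusH scaleH sgnH uniformityH openH innerH \<and>
        class.complete_space distH uniformityH openH \<and>
        (\<forall>x y. T (x + y) = plusH (T x) (T y)) \<and>
        (\<forall>r x. T (r *\<^sub>R x) = scaleH r (T x)) \<and>
        homeomorphic_map euclidean (topology openH) T)"

lemma isomorphic_to_Hilbert_space_inner:
  fixes p :: "'a::banach \<Rightarrow> 'a \<Rightarrow> real"
  assumes sym: "\<And>x y. p x y = p y x"
    and add: "\<And>x y z. p (x + y) z = p x z + p y z"
    and scale: "\<And>r x y. p (r *\<^sub>R x) y = r * p x y"
    and c: "c > 0" "\<And>x. c * norm x \<le> sqrt (p x x)"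
    and C: "\<And>x. sqrt (p x x) \<le> C * norm x"
  shows "isomorphic_to_Hilbert_space TYPE('a)"
proof -
  define N where "N x = sqrt (p x x)" for x
  define d where "d x y = N (x - y)" for x y
  define s where "s x = inverse (N x) *\<^sub>R x" for x
  define U where "U = (INF e\<in>{0<..}. principal {(x, y). d x y < e})"
  have zero: "p 0 0 = 0" using scale[of 0 0 0] by simp
  have N_nonneg: "0 \<le> N x" for x
    using c(2)[of x] c(1) unfolding N_def
    by (meson mult_nonneg_nonneg norm_ge_zero order_trans less_imp_le)
  have p_nonneg: "0 \<le> p x x" for x using N_nonneg[of x] by (simp add: N_def)
  have p_zero: "p x x = 0 \<longleftrightarrow> x = 0" for x
    using c(2)[of x] c(1) zero by (auto simp: mult_le_0_iff)
  define C' where "C' = max C 1"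
  have C': "C' > 0" "N x \<le> C' * norm x" for x
  proof -
    show "C' > 0" by (simp add: C'_def)
    have "C * norm x \<le> C' * norm x" by (rule mult_right_mono) (auto simp: C'_def)
    with C[of x] show "N x \<le> C' * norm x" by (simp add: N_def)
  qed
  have cN: "c * norm x \<le> N x" for x using c(2)[of x] by (simp add: N_def)
  have U_eq: "U = uniformity"
  proof (rule antisym)
    show "U \<le> uniformity"
      unfolding uniformity_dist U_def
    proof (rule INF_mono)
      fix e :: real assume "e \<in> {0<..}"
      then have e: "e > 0" by simp
      have "dist x y < e" if "d x y < c * e" for x y
      proof -
        have "c * norm (x - y) < c * e" using cN[of "x - y"] that by (simp add: d_def)
        then show ?thesis using c(1) by (simp add: dist_norm)
      qed
      then show "\<exists>m\<in>{0<..}. principal {(x, y). d x y < m} \<le> principal {(x, y). dist x y < e}"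
        using e c(1) by (intro bexI[of _ "c * e"]) auto
    qed
    show "uniformity \<le> U"
      unfolding uniformity_dist U_def
    proof (rule INF_mono)
      fix e :: real assume "e \<in> {0<..}"
      then have e: "e > 0" by simp
      have "d x y < e" if "dist x y < e / C'" for x y
      proof -
        have "C' * norm (x - y) < e" using that C'(1) by (simp add: dist_norm field_simps)
        then show ?thesis using C'(2)[of "x - y"] by (simp add: d_def)
      qed
      then show "\<exists>m\<in>{0<..}. principal {(x, y). dist x y < m} \<le> principal {(x, y). d x y < e}"
        using e C'(1) by (intro bexI[of _ "e / C'"]) auto
    qed
  qed
  have inner: "class.real_inner (-) d N (+) 0 uminus scaleR s U open p"
  proof
    fix x y z :: 'a and r r' :: real
    show "d x y = N (x - y)" by (fact d_def)
    show "s x = inverse (N x) *\<^sub>R x" by (fact s_def)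
    show "U = (INF e\<in>{0<..}. principal {(x, y). d x y < e})" by (fact U_def)
    show "N x = sqrt (p x x)" by (fact N_def)
    show "p x y = p y x" by (fact sym)
    show "p (x + y) z = p x z + p y z" by (fact add)
    show "p (r *\<^sub>R x) y = r * p x y" by (fact scale)
    show "0 \<le> p x x" by (fact p_nonneg)
    show "p x x = 0 \<longleftrightarrow> x = 0" by (fact p_zero)
    fix A :: "'a set"
    show "open A \<longleftrightarrow> (\<forall>x\<in>A. \<forall>\<^sub>F (x', y) in U. x' = x \<longrightarrow> y \<in> A)"
      by (simp add: U_eq open_uniformity)
  qed
  have "class.metric_space d U open"
  proof -
    interpret H: real_inner "(-)" d N "(+)" 0 uminus scaleR s U "open" p by (fact inner)
    show ?thesis
    proof
      fix x y z :: 'a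
      show "d x y = 0 \<longleftrightarrow> x = y" by (simp add: d_def N_def p_zero)
      have "d x y = N ((x - z) + (z - y))" by (simp add: d_def)
      also have "\<dots> \<le> N (x - z) + N (z - y)" by (rule H.norm_triangle_ineq)
      also have "N (z - y) = N (y - z)"
        using scale[of "-1" "y - z" "z - y"] scale[of "-1" "y - z" "y - z"] sym[of "y - z" "z - y"]
        by (simp add: N_def)
      finally show "d x y \<le> d x z + d y z" by (simp add: d_def)
    qed
  qed
  then have complete: "class.complete_space d U open"
    using complete_space_class.complete_space_axioms[where ?'a = 'a]
    by (simp add: class.complete_space_def U_eq)
  have "homeomorphic_map euclidean (topology open) (\<lambda>x::'a. x)"
    by (simp add: homeomorphic_map_id[unfolded id_def])
  with inner complete show ?thesis
    unfolding isomorphic_to_Hilbert_space_def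
    by (intro exI[of _ "(-)"] exI[of _ d] exI[of _ N] exI[of _ "(+)"] exI[of _ 0] exI[of _ uminus]
        exI[of _ scaleR] exI[of _ s] exI[of _ U] exI[of _ "open"] exI[of _ p] exI[of _ "\<lambda>x. x"]) auto
qed

lemma bounded_linear_if_continuous:
  fixes T :: "'a::real_normed_vector \<Rightarrow> 'b::real_normed_vector"
  assumes "linear T" and "continuous_on UNIV T"
  shows "bounded_linear T"
proof -
  interpret linear T by fact
  have "isCont T 0" using assms(2) by (simp add: continuous_on_eq_continuous_at)
  then obtain d where d: "d > 0" "\<And>x. dist x 0 < d \<Longrightarrow> dist (T x) (T 0) < 1"
    unfolding continuous_at_eps_delta by (meson zero_less_one)
  have "norm (T x) \<le> norm x * (2 / d)" for x
  proof (cases "x = 0")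
    case False
    define r where "r = d / (2 * norm x)"
    have r: "r > 0" using False d(1) by (simp add: r_def)
    have "dist (r *\<^sub>R x) 0 < d" using False d(1) by (simp add: r_def)
    from d(2)[OF this] have "r * norm (T x) < 1" using r by (simp add: scale)
    then show ?thesis using False d(1) by (simp add: r_def field_simps)
  qed simp
  then show ?thesis by unfold_locales blast
qed

lemma isomorphic_to_Hilbert_spaceI:
  fixes T :: "'a::banach \<Rightarrow> 'h::{real_inner,complete_space}"
  assumes "linear T" and "homeomorphic_map euclidean euclidean T"
  shows "isomorphic_to_Hilbert_space TYPE('a)"
proof -
  obtain S where hm: "homeomorphic_maps euclidean euclidean T S"
    using assms(2) homeomorphic_map_maps by blast
  then have ST: "\<And>x. S (T x) = x" and TS: "\<And>y. T (S y) = y"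
    and contT: "continuous_on UNIV T" and contS: "continuous_on UNIV S"
    by (auto simp: homeomorphic_maps_def)
  interpret T: linear T by fact
  have "linear S"
    by (rule linearI) (metis ST TS T.add, metis ST TS T.scale)
  then have S: "bounded_linear S" and T: "bounded_linear T"
    using assms(1) contS contT by (auto intro: bounded_linear_if_continuous)
  obtain K where K: "K > 0" "\<And>y. norm (S y) \<le> norm y * K"
    using bounded_linear.pos_bounded[OF S] by blast
  obtain C where C: "\<And>x. norm (T x) \<le> norm x * C"
    using bounded_linear.bounded[OF T] by blast
  show ?thesis
  proof (rule isomorphic_to_Hilbert_space_inner)
    show "T x \<bullet> T y = T y \<bullet> T x" for x y by (rule inner_commute)
    show "T (x + y) \<bullet> T z = T x \<bullet> T z + T y \<bullet> T z" for x y z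
      by (simp add: T.add inner_add_left)
    show "T (r *\<^sub>R x) \<bullet> T y = r * (T x \<bullet> T y)" for r x y by (simp add: T.scale)
    show "1 / K > 0" using K(1) by simp
    show "1 / K * norm x \<le> sqrt (T x \<bullet> T x)" for x
      using K(2)[of "T x"] K(1) by (simp add: ST field_simps flip: norm_eq_sqrt_inner)
    show "sqrt (T x \<bullet> T x) \<le> C * norm x" for x
      using C[of x] by (simp add: mult.commute flip: norm_eq_sqrt_inner)
  qed
qed

lemma continuous_quadratic_form_differentiable:
  assumes "continuous_quadratic_form q"
  shows "q differentiable (at x)"
proof -
  obtain a where a: "bounded_bilinear a" "q = (\<lambda>x. 1/2 * a x x)"
    using assms unfolding continuous_quadratic_form_def by blast
  have "((\<lambda>x. 1/2 * a x x) has_derivative (\<lambda>h. 1/2 * (a x h + a h x))) (at x)"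
    by (intro has_derivative_mult_right bounded_bilinear.FDERIV[OF a(1)] has_derivative_ident)
  then show ?thesis unfolding a(2) by (rule differentiableI)
qed

text \<open>The zero form violates the strict inequality at every point, so it has to be excluded.\<close>

lemma zero_quadratic_form:
  "continuous_quadratic_form (\<lambda>x::'a::real_normed_vector. 0)"
  "\<not> (0 < \<epsilon> * onorm (frechet_derivative (\<lambda>x::'a. 0 :: real) (at x)) * norm x)"
proof -
  show "continuous_quadratic_form (\<lambda>x::'a. 0)"
    unfolding continuous_quadratic_form_def
    by (intro exI[of _ "\<lambda>_ _. 0"]) (simp add: bounded_bilinear.intro exI[of _ 0])
  show "\<not> (0 < \<epsilon> * onorm (frechet_derivative (\<lambda>x::'a. 0 :: real) (at x)) * norm x)"
    by (simp add: frechet_derivative_const onorm_zero)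
qed

end

theory Submission
  imports Defs
begin

text \<open>
  Write \<open>q x = b x x / 2\<close> with \<open>b\<close> bounded, bilinear and symmetric; then \<open>b x\<close> is the derivative
  of \<open>q\<close> at \<open>x\<close>. If the conclusion fails, \<open>\<parallel>b x\<parallel> * \<parallel>x\<parallel> \<le> K * b x x\<close> for all \<open>x\<close>, where
  \<open>K = 1 / (2 * \<epsilon>)\<close>. In particular \<open>b\<close> is positive semidefinite, and it suffices to bound \<open>b x x\<close>
  from below on the unit sphere, because \<open>b\<close> is then an inner product whose norm is equivalent to
  the given one.

  If \<open>b x x\<close> is small for a unit vector \<open>x\<close>, then so is the functional \<open>b x\<close>, by the inequality.
  Fix \<open>e\<close> with \<open>b e e > 0\<close>, so that \<open>b e\<close> is not zero, then a large number \<open>t\<close>, and look at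
  \<open>e + t *\<^sub>R x\<close>: if \<open>b x x\<close> is small enough, adding \<open>t *\<^sub>R x\<close> changes \<open>b e\<close> and \<open>b e e\<close> hardly at
  all, but it makes the vector long. So the left side of the inequality at \<open>e + t *\<^sub>R x\<close> is at least
  about \<open>\<parallel>b e\<parallel> * (t - \<parallel>e\<parallel>)\<close>, while the right side stays near \<open>K * b e e\<close>, which is absurd for
  large \<open>t\<close>. Hence \<open>b x x\<close> cannot be small; this is \<open>coercive_if_functionals_controlled\<close>.
\<close>

text \<open>
  With \<open>y = e\<close>, the hypothesis \<open>ctrl\<close> at a unit vector \<open>u\<close> bounds \<open>b u e\<close> by a multiple of
  \<open>b u u\<close>. At \<open>e + t *\<^sub>R u\<close> it then becomes an inequality whose only dependence on \<open>u\<close> is through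
  \<open>b u u\<close>, and which fails at \<open>b u u = 0\<close> once \<open>t\<close> is large; solving it for \<open>b u u\<close> gives the
  constant \<open>1 / M\<close>.
\<close>

lemma coercive_if_functionals_controlled:
  fixes b :: "'a::real_normed_vector \<Rightarrow> 'a \<Rightarrow> real"
  assumes b: "bounded_bilinear b"
    and sym: "\<And>x y. b x y = b y x"
    and K: "K > 0"
    and ctrl: "\<And>x y. \<bar>b x y\<bar> * norm x \<le> K * b x x * norm y"
    and e: "b e e > 0"
  obtains c where "c > 0" "\<And>x. c * (norm x)\<^sup>2 \<le> b x x"
proof -
  interpret bounded_bilinear b by (fact b)
  define n where "n = norm e"
  define s where "s = K * n + 1 / b e e"
  define t where "t = n + s"
  define M where "M = K * n * (t * s + 2 * t * (K * n) + t\<^sup>2)"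
  have n: "n > 0" using e zero_left by (auto simp: n_def)
  have s: "s > 0" using n e K by (simp add: s_def add_pos_pos)
  have t: "t > 0" using n s by (simp add: t_def)
  have M: "M > 0" using n s t K by (simp add: M_def add_pos_pos)
  have unit: "1 / M \<le> b u u" if u: "norm u = 1" for u
  proof -
    have small: "\<bar>b u e\<bar> \<le> K * b u u * n"
      using ctrl[of u e] u by (simp add: n_def)
    have "t = norm (t *\<^sub>R u)" using u t by simp
    also have "\<dots> \<le> norm (e + t *\<^sub>R u) + norm e"
      using norm_triangle_ineq4[of "e + t *\<^sub>R u" e] by simp
    finally have far: "s \<le> norm (e + t *\<^sub>R u)" by (simp add: t_def n_def)
    have "b (e + t *\<^sub>R u) e = b e e + t * b u e"
      by (simp add: add_left scaleR_left)
    moreover have "t * (- b u e) \<le> t * (K * b u u * n)"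
      using small t by (intro mult_left_mono) auto
    ultimately have "b e e - t * (K * b u u * n) \<le> \<bar>b (e + t *\<^sub>R u) e\<bar>"
      by simp
    then have "(b e e - t * (K * b u u * n)) * s \<le> \<bar>b (e + t *\<^sub>R u) e\<bar> * s"
      using s by (intro mult_right_mono) auto
    also have "\<dots> \<le> \<bar>b (e + t *\<^sub>R u) e\<bar> * norm (e + t *\<^sub>R u)"
      using far by (intro mult_left_mono) auto
    also have "\<dots> \<le> K * b (e + t *\<^sub>R u) (e + t *\<^sub>R u) * n"
      using ctrl by (simp add: n_def)
    also have "b (e + t *\<^sub>R u) (e + t *\<^sub>R u) = b e e + 2 * t * b u e + t\<^sup>2 * b u u"
      by (simp add: add_left add_right scaleR_left scaleR_right sym[of e u] power2_eq_square algebra_simps)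
    also have "K * (b e e + 2 * t * b u e + t\<^sup>2 * b u u) * n
        \<le> K * (b e e + 2 * t * (K * b u u * n) + t\<^sup>2 * b u u) * n"
      using small t K n by (intro mult_right_mono mult_left_mono add_mono) auto
    finally have "b e e * s - K * n * b e e \<le> M * b u u"
      by (simp add: M_def algebra_simps)
    \<comment> \<open>The number \<open>s\<close> is chosen so that the terms without \<open>b u u\<close> differ by exactly \<open>1\<close>.\<close>
    moreover have "b e e * s - K * n * b e e = 1"
      using e by (simp add: s_def field_simps)
    ultimately show ?thesis using M by (simp add: field_simps)
  qed
  have "1 / M * (norm x)\<^sup>2 \<le> b x x" for x
  proof (cases "x = 0")
    case False
    define u where "u = x /\<^sub>R norm x"
    have "norm u = 1" and x: "x = norm x *\<^sub>R u" using False by (simp_all add: u_def)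
    have "1 / M * (norm x)\<^sup>2 \<le> b u u * (norm x)\<^sup>2"
      using unit[OF \<open>norm u = 1\<close>] by (rule mult_right_mono) simp
    also have "\<dots> = b (norm x *\<^sub>R u) (norm x *\<^sub>R u)"
      by (simp only: scaleR_left scaleR_right) (simp add: power2_eq_square)
    finally show ?thesis using x by simp
  qed (simp add: zero_left)
  with M show ?thesis by (intro that[of "1 / M"]) auto
qed

lemma isomorphic_to_Hilbert_space_if_coercive:
  fixes b :: "'a::banach \<Rightarrow> 'a \<Rightarrow> real"
  assumes b: "bounded_bilinear b"
    and sym: "\<And>x y. b x y = b y x"
    and c: "c > 0" "\<And>x. c * (norm x)\<^sup>2 \<le> b x x"
  shows "isomorphic_to_Hilbert_space TYPE('a)"
proof -
  interpret bounded_bilinear b by (fact b)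
  obtain C where C: "\<And>x y. norm (b x y) \<le> norm x * norm y * C"
    using bounded by blast
  show ?thesis
  proof (rule isomorphic_to_Hilbert_space_inner[where p = b and c = "sqrt c" and C = "sqrt C"])
    fix x y z :: 'a and r :: real
    show "b x y = b y x" by (fact sym)
    show "b (x + y) z = b x z + b y z" by (fact add_left)
    show "b (r *\<^sub>R x) y = r * b x y" by (simp add: scaleR_left)
    show "sqrt c > 0" using c(1) by simp
    show "sqrt c * norm x \<le> sqrt (b x x)"
      using real_sqrt_le_mono[OF c(2)[of x]] by (simp add: real_sqrt_mult)
    have "b x x \<le> C * (norm x)\<^sup>2"
      using C[of x x] by (simp add: power2_eq_square algebra_simps)
    then show "sqrt (b x x) \<le> sqrt C * norm x"
      using real_sqrt_le_mono by (fastforce simp: real_sqrt_mult)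
  qed
qed

lemma continuous_quadratic_form_polarization:
  fixes q :: "'a::real_normed_vector \<Rightarrow> real"
  assumes "continuous_quadratic_form q"
  obtains b where "bounded_bilinear b" "\<And>x y. b x y = b y x" "\<And>x. q x = b x x / 2"
    "\<And>x. frechet_derivative q (at x) = b x"
proof -
  obtain a where a: "bounded_bilinear a" "q = (\<lambda>x. 1/2 * a x x)"
    using assms unfolding continuous_quadratic_form_def by blast
  interpret a: bounded_bilinear a by (fact a(1))
  define b where "b x y = 1/2 * (a x y + a y x)" for x y
  have "bounded_bilinear b"
  proof
    fix x x' y y' :: 'a and r :: real
    show "b (x + x') y = b x y + b x' y" "b x (y + y') = b x y + b x y'"
      by (simp_all add: b_def a.add_left a.add_right algebra_simps)
    show "b (r *\<^sub>R x) y = r *\<^sub>R b x y" "b x (r *\<^sub>R y) = r *\<^sub>R b x y"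
      by (simp_all add: b_def a.scaleR_left a.scaleR_right algebra_simps)
    obtain C where C: "\<And>x y. norm (a x y) \<le> norm x * norm y * C"
      using a.bounded by blast
    have "norm (b x y) \<le> norm x * norm y * C" for x y
      using C[of x y] C[of y x] by (simp add: b_def mult.commute[of "norm y"])
    then show "\<exists>C. \<forall>x y. norm (b x y) \<le> norm x * norm y * C" by blast
  qed
  moreover have "frechet_derivative q (at x) = b x" for x
  proof -
    have "(q has_derivative (\<lambda>h. 1/2 * (a x h + a h x))) (at x)"
      unfolding a(2)
      by (intro has_derivative_mult_right bounded_bilinear.FDERIV[OF a(1)] has_derivative_ident)
    then have "(q has_derivative b x) (at x)" by (simp add: b_def[abs_def])
    then show ?thesis by (rule frechet_derivative_at[symmetric])
  qed
  ultimately show ?thesis by (intro that[of b]) (auto simp: b_def a(2))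
qed

theorem proposition4p9:
  fixes q :: "'a::banach \<Rightarrow> real" and \<epsilon> :: real
  assumes "\<not> isomorphic_to_Hilbert_space TYPE('a)"
    and "continuous_quadratic_form q"
    and "\<exists>x. q x \<noteq> 0"
    and "\<epsilon> > 0"
  shows "\<exists>x. q x < \<epsilon> * onorm (frechet_derivative q (at x)) * norm x"
proof (rule ccontr)
  assume "\<not> ?thesis"
  then have neg: "\<epsilon> * onorm (frechet_derivative q (at x)) * norm x \<le> q x" for x
    by (simp add: not_less)
  obtain b where b: "bounded_bilinear b" and sym: "\<And>x y. b x y = b y x"
    and q: "\<And>x. q x = b x x / 2" and q': "\<And>x. frechet_derivative q (at x) = b x"
    using continuous_quadratic_form_polarization[OF assms(2)] by blast
  have lin: "bounded_linear (b x)" for x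
    by (rule bounded_bilinear.bounded_linear_right[OF b])
  have ctrl: "\<bar>b x y\<bar> * norm x \<le> 1 / (2 * \<epsilon>) * b x x * norm y" for x y
  proof -
    have "\<bar>b x y\<bar> * norm x \<le> onorm (b x) * norm y * norm x"
      using onorm[OF lin, of x y] by (intro mult_right_mono) auto
    also have "\<dots> = onorm (b x) * norm x * norm y" by simp
    also have "\<dots> \<le> 1 / (2 * \<epsilon>) * b x x * norm y"
      using neg[of x] assms(4) by (intro mult_right_mono) (auto simp: q q' field_simps)
    finally show ?thesis .
  qed
  have "0 \<le> q x" for x
  proof -
    have "0 \<le> \<epsilon> * onorm (b x) * norm x"
      using onorm_pos_le[OF lin] assms(4) by simp
    then show ?thesis using neg[of x] by (simp add: q')
  qed
  then obtain e where "b e e > 0"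
    using assms(3) q by (metis half_gt_zero_iff less_eq_real_def)
  then obtain c where "c > 0" "\<And>x. c * (norm x)\<^sup>2 \<le> b x x"
    using coercive_if_functionals_controlled[OF b sym _ ctrl] assms(4) by auto
  then show False
    using isomorphic_to_Hilbert_space_if_coercive[OF b sym] assms(1) by blast
qed

end
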